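(* The following two statements are equivalent (i.e. each one, if true, implies the other). (PC) For every $\epsilon>0$ there is a natural number $r$ such that for every natural number $n$ and every linear operator $T$ on $\ell_2^n$ whose matrix has zero diagonal, there is a partition $\{A_j\}_{j=1}^r$ of $\{1,\dots,n\}$ with $\|Q_{A_j}TQ_{A_j}\|\le \epsilon\|T\|$ for all $j=1,\dots,r$. (PC for triangular matrices) For every $\epsilon>0$ there is a natural number $r$ such that for every natural number $n$ and every linear operator $T$ on $\ell_2^n$ whose matrix is triangular with zero diagonal, there is a partition $\{A_j\}_{j=1}^r$ of $\{1,\dots,n\}$ with $\|Q_{A_j}TQ_{A_j}\|\le \epsilon\|T\|$ for all $j=1,\dots,r$.
   Context: Matrices of operators on $\ell_2^n$ are taken with respect to the standard orthonormal basis $\{e_i\}_{i=1}^n$, i.e. the matrix of $T$ is $(\langle Te_i,e_j\rangle)_{i,j}$. For $A\subset\{1,\dots,n\}$, the diagonal projection $Q_A$ is the matrix whose entries are all zero except the $(i,i)$ entries for $i\in A$, which equal $1$. The number $r$ depends only on $\epsilon$, not on $n$ or $T$. *)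

theory Defs
  imports "HOL-Analysis.Analysis"
begin

text \<open>An operator T on the complex space l2^n is represented by its n x n matrix
  M :: nat => nat => complex, indices in {1..n}, acting by (T x)_i = sum_j M i j * x j.
  Vectors are functions nat => complex; only coordinates 1..n matter.\<close>

definition mat_apply :: "nat \<Rightarrow> (nat \<Rightarrow> nat \<Rightarrow> complex) \<Rightarrow> (nat \<Rightarrow> complex) \<Rightarrow> (nat \<Rightarrow> complex)" where
  "mat_apply n M x = (\<lambda>i. \<Sum>j=1..n. M i j * x j)"

definition l2_norm_n :: "nat \<Rightarrow> (nat \<Rightarrow> complex) \<Rightarrow> real" where
  "l2_norm_n n x = sqrt (\<Sum>i=1..n. (cmod (x i))\<^sup>2)"

definition op_norm :: "nat \<Rightarrow> (nat \<Rightarrow> nat \<Rightarrow> complex) \<Rightarrow> real" where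
  "op_norm n M = Sup ((\<lambda>x. l2_norm_n n (mat_apply n M x)) ` {x. l2_norm_n n x \<le> 1})"

definition compress :: "nat set \<Rightarrow> (nat \<Rightarrow> nat \<Rightarrow> complex) \<Rightarrow> (nat \<Rightarrow> nat \<Rightarrow> complex)" where
  "compress A M = (\<lambda>i j. if i \<in> A \<and> j \<in> A then M i j else 0)"

definition zero_diag :: "nat \<Rightarrow> (nat \<Rightarrow> nat \<Rightarrow> complex) \<Rightarrow> bool" where
  "zero_diag n M \<longleftrightarrow> (\<forall>i\<in>{1..n}. M i i = 0)"

definition triangular :: "nat \<Rightarrow> (nat \<Rightarrow> nat \<Rightarrow> complex) \<Rightarrow> bool" where
  "triangular n M \<longleftrightarrow>
     (\<forall>i\<in>{1..n}. \<forall>j\<in>{1..n}. j < i \<longrightarrow> M i j = 0) \<or>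
     (\<forall>i\<in>{1..n}. \<forall>j\<in>{1..n}. i < j \<longrightarrow> M i j = 0)"

text \<open>A_1,...,A_r is a partition of {1..n} (parts may be empty).\<close>
definition is_partition :: "nat \<Rightarrow> nat \<Rightarrow> (nat \<Rightarrow> nat set) \<Rightarrow> bool" where
  "is_partition n r A \<longleftrightarrow>
     (\<Union>j\<in>{1..r}. A j) = {1..n} \<and>
     (\<forall>j\<in>{1..r}. \<forall>k\<in>{1..r}. j \<noteq> k \<longrightarrow> A j \<inter> A k = {})"

end

theory Submission
  imports Defs
begin

text \<open>Let \<open>S\<close> be Hermitian with zero diagonal and \<open>-1 \<le> S \<le> 1\<close>, and factor \<open>2 + S = L L\<^sup>*\<close> with \<open>L\<close> lower
  triangular. Although \<open>2 + S\<close> is only bounded below by \<open>1\<close>, the zero diagonal forces every diagonal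
  entry of \<open>L\<close> to be at least \<open>sqrt (3/2)\<close>. Paving the strictly triangular part of \<open>L\<^sup>*\<close> makes
  \<open>Q L\<^sup>* Q\<close> nearly diagonal, so \<open>Q (2 + S) Q \<ge> Q L Q L\<^sup>* Q\<close> is bounded below by nearly \<open>3/2\<close>, that is
  \<open>Q S Q \<ge> -3/4\<close>. The same for \<open>-S\<close> gives \<open>\<parallel>Q S Q\<parallel> \<le> 3/4\<close>, and iteration gives \<open>(3/4)^m\<close>. A general
  operator is treated through its real and imaginary parts.\<close>

section \<open>Quadratic forms and squared norms over an index set\<close>

text \<open>The index set is an argument, so that compressing to \<open>B\<close> only means
  replacing \<open>A\<close> by \<open>B\<close> with the matrix unchanged.\<close>

definition qform :: "nat set \<Rightarrow> (nat \<Rightarrow> nat \<Rightarrow> complex) \<Rightarrow> (nat \<Rightarrow> complex) \<Rightarrow> complex" where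
  "qform A S x = (\<Sum>i\<in>A. \<Sum>j\<in>A. cnj (x i) * S i j * x j)"

definition sqnorm :: "nat set \<Rightarrow> (nat \<Rightarrow> complex) \<Rightarrow> real" where
  "sqnorm A x = (\<Sum>i\<in>A. (cmod (x i))\<^sup>2)"

definition hermitian_on :: "nat set \<Rightarrow> (nat \<Rightarrow> nat \<Rightarrow> complex) \<Rightarrow> bool" where
  "hermitian_on A S \<longleftrightarrow> (\<forall>i\<in>A. \<forall>j\<in>A. S j i = cnj (S i j))"

lemma hermitian_on_subset: "hermitian_on A S \<Longrightarrow> B \<subseteq> A \<Longrightarrow> hermitian_on B S"
  unfolding hermitian_on_def by blast

lemma hermitian_on_cmult_real:
  assumes "hermitian_on A S" shows "hermitian_on A (\<lambda>i j. complex_of_real c * S i j)"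
  unfolding hermitian_on_def
proof (intro ballI)
  fix i j assume "i \<in> A" "j \<in> A"
  then have "S j i = cnj (S i j)" using assms unfolding hermitian_on_def by blast
  then show "complex_of_real c * S j i = cnj (complex_of_real c * S i j)" by simp
qed

lemma sqnorm_nonneg [simp]: "0 \<le> sqnorm A x"
  by (simp add: sqnorm_def sum_nonneg)

lemma l2_norm_n_sqnorm: "l2_norm_n n x = sqrt (sqnorm {1..n} x)"
  by (simp add: l2_norm_n_def sqnorm_def)

lemma sqrt_sqnorm_eq_L2: "sqrt (sqnorm A x) = L2_set (\<lambda>i. cmod (x i)) A"
  by (simp add: sqnorm_def L2_set_def)

lemma sqnorm_triangle:
  "sqrt (sqnorm A (\<lambda>i. x i + y i)) \<le> sqrt (sqnorm A x) + sqrt (sqnorm A y)"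
proof -
  have "L2_set (\<lambda>i. cmod (x i + y i)) A \<le> L2_set (\<lambda>i. cmod (x i) + cmod (y i)) A"
    by (intro L2_set_mono) (auto simp: norm_triangle_ineq)
  also have "\<dots> \<le> L2_set (\<lambda>i. cmod (x i)) A + L2_set (\<lambda>i. cmod (y i)) A"
    by (rule L2_set_triangle_ineq)
  finally show ?thesis by (simp add: sqrt_sqnorm_eq_L2)
qed

lemma sqnorm_mono: "finite A \<Longrightarrow> B \<subseteq> A \<Longrightarrow> sqnorm B x \<le> sqnorm A x"
  unfolding sqnorm_def by (rule sum_mono2) auto

lemma sqnorm_cong: "(\<And>i. i \<in> A \<Longrightarrow> x i = y i) \<Longrightarrow> sqnorm A x = sqnorm A y"
  by (simp add: sqnorm_def)

lemma sqnorm_restrict: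
  assumes "finite A" "B \<subseteq> A"
  shows "sqnorm A (\<lambda>i. if i \<in> B then x i else 0) = sqnorm B x"
proof -
  have "sqnorm A (\<lambda>i. if i \<in> B then x i else 0) = (\<Sum>i\<in>A. if i \<in> B then (cmod (x i))\<^sup>2 else 0)"
    unfolding sqnorm_def by (intro sum.cong) auto
  also have "\<dots> = sqnorm B x"
    unfolding sqnorm_def using assms by (simp add: sum.inter_restrict[symmetric] Int_absorb1)
  finally show ?thesis .
qed

lemma qform_restrict:
  assumes "finite A" "B \<subseteq> A"
  shows "qform A S (\<lambda>i. if i \<in> B then x i else 0) = qform B S x"
proof -
  have "qform A S (\<lambda>i. if i \<in> B then x i else 0)
      = (\<Sum>i\<in>A. if i \<in> B then (\<Sum>j\<in>A. if j \<in> B then cnj (x i) * S i j * x j else 0) else 0)"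
    unfolding qform_def by (intro sum.cong) (auto intro!: sum.cong sum.neutral)
  also have "\<dots> = qform B S x"
    unfolding qform_def using assms by (simp add: sum.inter_restrict[symmetric] Int_absorb1)
  finally show ?thesis .
qed

lemma qform_minus: "qform A (\<lambda>i j. - S i j) x = - qform A S x"
  by (simp add: qform_def sum_negf)

lemma qform_cmult: "qform A (\<lambda>i j. c * S i j) x = c * qform A S x"
  by (simp add: qform_def sum_distrib_left mult_ac)

lemma qform_add: "qform A (\<lambda>i j. S i j + T i j) x = qform A S x + qform A T x"
  by (simp add: qform_def sum.distrib algebra_simps)

lemma cnj_mult_self: "cnj z * z = (complex_of_real (cmod z))\<^sup>2"
  using complex_norm_square[of z] by (simp add: mult.commute)

lemma qform_scalar:
  assumes "finite A"
  shows "qform A (\<lambda>i j. if i = j then c else 0) x = c * of_real (sqnorm A x)"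
proof -
  have "qform A (\<lambda>i j. if i = j then c else 0) x = (\<Sum>i\<in>A. \<Sum>j\<in>A. if i = j then c * of_real ((cmod (x i))\<^sup>2) else 0)"
    unfolding qform_def by (intro sum.cong) (auto simp: cnj_mult_self[symmetric])
  then show ?thesis using assms by (simp add: sqnorm_def sum_distrib_left)
qed

lemma qform_adjoint: "qform A (\<lambda>i j. cnj (S j i)) x = cnj (qform A S x)"
  unfolding qform_def cnj_sum by (subst sum.swap) (simp add: mult_ac)

text \<open>Isolates one coordinate. This drives both the Schur complement step of
  \<open>cholesky\<close> and the rescaling of a single coordinate in
  \<open>coercive_coordinate\<close>.\<close>

lemma qform_insert:
  assumes "finite A" "b \<notin> A"
  shows "qform (insert b A) P v = cnj (v b) * P b b * v b + cnj (v b) * (\<Sum>j\<in>A. P b j * v j)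
    + (\<Sum>i\<in>A. cnj (v i) * P i b) * v b + qform A P v"
  using assms by (simp add: qform_def sum.distrib sum_distrib_left sum_distrib_right algebra_simps)

text \<open>If \<open>P\<close> is \<open>L L\<^sup>*\<close>, its form at \<open>x\<close> is the
  squared norm of \<open>L\<^sup>* x\<close>; the vector inside \<open>sqnorm\<close> is
  \<open>L\<^sup>* x\<close> written out.\<close>

lemma qform_gram:
  assumes "\<And>i j. i \<in> A \<Longrightarrow> j \<in> A \<Longrightarrow> P i j = (\<Sum>k\<in>A. L i k * cnj (L j k))"
  shows "qform A P x = of_real (sqnorm A (\<lambda>k. \<Sum>i\<in>A. cnj (L i k) * x i))"
proof -
  have "qform A P x = (\<Sum>i\<in>A. \<Sum>j\<in>A. \<Sum>k\<in>A. (L i k * cnj (x i)) * (cnj (L j k) * x j))"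
    unfolding qform_def
    by (intro sum.cong refl) (simp add: assms sum_distrib_left sum_distrib_right mult_ac)
  also have "\<dots> = (\<Sum>i\<in>A. \<Sum>k\<in>A. \<Sum>j\<in>A. (L i k * cnj (x i)) * (cnj (L j k) * x j))"
    by (intro sum.cong refl sum.swap)
  also have "\<dots> = (\<Sum>k\<in>A. \<Sum>i\<in>A. \<Sum>j\<in>A. (L i k * cnj (x i)) * (cnj (L j k) * x j))"
    by (rule sum.swap)
  also have "\<dots> = (\<Sum>k\<in>A. cnj (\<Sum>i\<in>A. cnj (L i k) * x i) * (\<Sum>i\<in>A. cnj (L i k) * x i))"
    by (intro sum.cong refl) (simp add: sum_product)
  finally show ?thesis by (simp add: sqnorm_def cnj_mult_self[symmetric])
qed

section \<open>Cholesky factors with a lower bound on the diagonal\<close>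

text \<open>Cholesky factorisation by eliminating the smallest index: the Schur complement inherits the
  hypothesis because its form at \<open>v\<close> is the value of the original form at the optimal extension of
  \<open>v\<close> to the eliminated coordinate.\<close>

lemma cholesky:
  assumes "finite A" "c > 0" "hermitian_on A P"
    and "\<And>v i. i \<in> A \<Longrightarrow> c * (cmod (v i))\<^sup>2 \<le> Re (qform A P v)"
  shows "\<exists>L. (\<forall>i\<in>A. \<forall>j\<in>A. i < j \<longrightarrow> L i j = 0) \<and> (\<forall>i\<in>A. \<exists>d. sqrt c \<le> d \<and> L i i = complex_of_real d)
    \<and> (\<forall>i\<in>A. \<forall>j\<in>A. P i j = (\<Sum>k\<in>A. L i k * cnj (L j k)))"
  using assms(1,3,4)
proof (induction A arbitrary: P rule: finite_linorder_min_induct)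
  case empty
  then show ?case by simp
next
  case (insert b A)
  have bA: "b \<notin> A" using insert.hyps(2) by blast
  have herm: "P j i = cnj (P i j)" if "i \<in> insert b A" "j \<in> insert b A" for i j
    using insert.prems(1) that unfolding hermitian_on_def by blast
  define p where "p = Re (P b b)"
  have Pbb: "P b b = of_real p"
    using herm[of b b] by (simp add: p_def complex_eq_iff)
  have "c \<le> p"
  proof -
    have "c * (cmod (if b = b then 1 else 0))\<^sup>2 \<le> Re (qform (insert b A) P (\<lambda>i. if i = b then 1 else 0))"
      using insert.prems(2)[of b "\<lambda>i. if i = b then 1 else 0"] by simp
    moreover have "qform A P (\<lambda>i. if i = b then 1 else 0) = 0"
      unfolding qform_def using bA by (intro sum.neutral) auto
    moreover have "(\<Sum>j\<in>A. P b j * (if j = b then 1 else 0)) = 0"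
      using bA by (intro sum.neutral) auto
    moreover have "(\<Sum>j\<in>A. cnj (if j = b then 1 else 0) * P j b) = 0"
      using bA by (intro sum.neutral) auto
    ultimately show ?thesis
      by (simp add: qform_insert[OF insert.hyps(1) bA] p_def)
  qed
  then have p: "p > 0" using assms(2) by simp
  define P' where "P' = (\<lambda>i j. P i j - P i b * P b j / p)"
  have "hermitian_on A P'"
    unfolding hermitian_on_def
  proof (intro ballI)
    fix i j assume "i \<in> A" "j \<in> A"
    then show "P' j i = cnj (P' i j)"
      using herm[of i j] herm[of b i] herm[of j b] by (simp add: P'_def)
  qed
  moreover have "c * (cmod (v i))\<^sup>2 \<le> Re (qform A P' v)" if i: "i \<in> A" for v i
  proof -
    define s where "s = (\<Sum>j\<in>A. P b j * v j)"
    have cs: "(\<Sum>i\<in>A. cnj (v i) * P i b) = cnj s"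
      unfolding s_def cnj_sum by (intro sum.cong refl) (simp add: herm[of b])
    \<comment> \<open>Completing the square: \<open>- s / p\<close> is the value at coordinate
      \<open>b\<close> that minimises the form.\<close>
    define u where "u = v(b := - s / p)"
    have u: "\<And>j. j \<in> A \<Longrightarrow> u j = v j" using bA by (auto simp: u_def)
    have "qform A P u = qform A P v"
      unfolding qform_def by (intro sum.cong) (auto simp: u)
    moreover have "(\<Sum>j\<in>A. P b j * u j) = s"
      unfolding s_def by (intro sum.cong) (auto simp: u)
    moreover have "(\<Sum>i\<in>A. cnj (u i) * P i b) = cnj s"
      unfolding cs[symmetric] by (intro sum.cong) (auto simp: u)
    ultimately have "qform (insert b A) P u = qform A P v - cnj s * s / p"
      using p by (simp add: qform_insert[OF insert.hyps(1) bA] Pbb u_def field_simps)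
    also have "\<dots> = qform A P v - (\<Sum>i\<in>A. \<Sum>j\<in>A. (cnj (v i) * P i b) * (P b j * v j)) / p"
      by (simp add: sum_product[symmetric] cs flip: s_def)
    also have "\<dots> = qform A P' v"
      unfolding qform_def P'_def sum_divide_distrib sum_subtractf[symmetric]
      by (intro sum.cong refl) (simp add: algebra_simps)
    finally have "qform (insert b A) P u = qform A P' v" .
    with insert.prems(2)[of i u] i u[OF i] show ?thesis by simp
  qed
  ultimately obtain L where L: "\<forall>i\<in>A. \<forall>j\<in>A. i < j \<longrightarrow> L i j = 0"
      "\<forall>i\<in>A. \<exists>d. sqrt c \<le> d \<and> L i i = complex_of_real d"
      "\<forall>i\<in>A. \<forall>j\<in>A. P' i j = (\<Sum>k\<in>A. L i k * cnj (L j k))"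
    using insert.IH by blast
  \<comment> \<open>Column \<open>b\<close> is chosen so that its outer product with itself is the
    rank one term subtracted in \<open>P'\<close>. As \<open>b\<close> is the smallest index, the
    rest of row \<open>b\<close> must vanish.\<close>
  define L' where "L' = (\<lambda>i j. if j = b then P i b / sqrt p else if i = b then 0 else L i j)"
  have sp: "complex_of_real (sqrt p) * complex_of_real (sqrt p) = of_real p"
    using p by (simp flip: of_real_mult)
  have "\<forall>i\<in>insert b A. \<forall>j\<in>insert b A. i < j \<longrightarrow> L' i j = 0"
    using L(1) insert.hyps(2) unfolding L'_def by (auto dest: less_asym)
  moreover have "\<forall>i\<in>insert b A. \<exists>d. sqrt c \<le> d \<and> L' i i = complex_of_real d"
  proof
    fix i assume "i \<in> insert b A"
    show "\<exists>d. sqrt c \<le> d \<and> L' i i = complex_of_real d"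
    proof (cases "i = b")
      case True
      have "sqrt c \<le> sqrt p" using \<open>c \<le> p\<close> by simp
      moreover have "L' i i = of_real (sqrt p)"
        using True p by (simp add: L'_def Pbb field_simps sp)
      ultimately show ?thesis by blast
    next
      case False
      then show ?thesis using L(2) \<open>i \<in> insert b A\<close> by (auto simp: L'_def)
    qed
  qed
  moreover have "P i j = (\<Sum>k\<in>insert b A. L' i k * cnj (L' j k))"
    if ij: "i \<in> insert b A" "j \<in> insert b A" for i j
  proof -
    have "(\<Sum>k\<in>insert b A. L' i k * cnj (L' j k)) = P i b * P b j / p
        + (\<Sum>k\<in>A. L' i k * cnj (L' j k))"
      using insert.hyps(1) bA ij herm[of j b] by (simp add: L'_def sp)
    moreover have "(\<Sum>k\<in>A. L' i k * cnj (L' j k)) = P i j - P i b * P b j / p"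
    proof (cases "i = b \<or> j = b")
      case True
      then have "(\<Sum>k\<in>A. L' i k * cnj (L' j k)) = 0"
        using bA by (intro sum.neutral) (auto simp: L'_def)
      then show ?thesis using True p by (auto simp: Pbb)
    next
      case False
      then have "(\<Sum>k\<in>A. L' i k * cnj (L' j k)) = (\<Sum>k\<in>A. L i k * cnj (L j k))"
        using bA by (intro sum.cong) (auto simp: L'_def)
      then show ?thesis using L(3) False ij by (auto simp: P'_def)
    qed
    ultimately show ?thesis by simp
  qed
  ultimately show ?case by (intro exI[of _ L']) blast
qed

text \<open>Equivalently, the diagonal of \<open>(2 + S)\<^sup>-\<^sup>1\<close> is at most \<open>2/3\<close>. The proof adds \<open>3/2\<close> times the bound
  \<open>-1 \<le> S\<close> at \<open>v\<close> with its \<open>i\<close>-th coordinate halved to \<open>1/2\<close> times the bound \<open>S \<le> 1\<close> at \<open>v\<close> with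
  that coordinate multiplied by \<open>-1/2\<close>.\<close>

lemma coercive_coordinate:
  assumes "finite A" "i \<in> A" "S i i = 0"
    and bd: "\<And>x. \<bar>Re (qform A S x)\<bar> \<le> sqnorm A x"
  shows "3/2 * (cmod (v i))\<^sup>2 \<le> Re (qform A (\<lambda>i j. (if i = j then 2 else 0) + S i j) v)"
proof -
  define B where "B = A - {i}"
  have A: "A = insert i B" "finite B" "i \<notin> B" using assms by (auto simp: B_def)
  define s where "s = (\<Sum>j\<in>B. S i j * v j)"
  define s' where "s' = (\<Sum>j\<in>B. cnj (v j) * S j i)"
  define h where "h = Re (cnj (v i) * s + s' * v i)"
  define g where "g = Re (qform B S v)"
  \<comment> \<open>The zero diagonal entry removes the \<open>t\<^sup>2\<close> term, so the form
    is affine in the factor \<open>t\<close>.\<close>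
  have 1: "Re (qform A S (v(i := of_real t * v i))) = g + t * h" for t
  proof -
    have "qform B S (v(i := of_real t * v i)) = qform B S v"
      unfolding qform_def using A by (intro sum.cong) auto
    moreover have "(\<Sum>j\<in>B. S i j * (v(i := of_real t * v i)) j) = s"
      unfolding s_def using A by (intro sum.cong) auto
    moreover have "(\<Sum>j\<in>B. cnj ((v(i := of_real t * v i)) j) * S j i) = s'"
      unfolding s'_def using A by (intro sum.cong) auto
    ultimately show ?thesis
      unfolding A(1) qform_insert[OF A(2,3)] using assms(3) by (simp add: h_def g_def algebra_simps)
  qed
  have 2: "sqnorm A (v(i := of_real t * v i)) = t\<^sup>2 * (cmod (v i))\<^sup>2 + sqnorm B v" for t
  proof -
    have "sqnorm B (v(i := of_real t * v i)) = sqnorm B v"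
      unfolding sqnorm_def using A by (intro sum.cong) auto
    then show ?thesis using A by (simp add: sqnorm_def norm_mult power_mult_distrib)
  qed
  have 3: "Re (qform A S v) = g + h" using 1[of 1] by simp
  have 4: "sqnorm A v = (cmod (v i))\<^sup>2 + sqnorm B v" using 2[of 1] by simp
  have 5: "- (1/4 * (cmod (v i))\<^sup>2 + sqnorm B v) \<le> g + h / 2"
    using bd[of "v(i := of_real (1/2) * v i)"] unfolding 1 2 by (simp add: power2_eq_square abs_le_iff)
  have 6: "g - h / 2 \<le> 1/4 * (cmod (v i))\<^sup>2 + sqnorm B v"
    using bd[of "v(i := of_real (-1/2) * v i)"] unfolding 1 2 by (simp add: power2_eq_square abs_le_iff)
  have 7: "Re (qform A (\<lambda>i j. (if i = j then 2 else 0) + S i j) v) = 2 * sqnorm A v + Re (qform A S v)"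
    unfolding qform_add qform_scalar[OF assms(1)] by simp
  \<comment> \<open>With weights 3/2 and 1/2 the two bounds give \<open>g + h\<close> at least
    \<open>-1/2 * (cmod (v i))\<^sup>2 - 2 * sqnorm B v\<close>; adding
    \<open>2 * sqnorm A v\<close> cancels the part on \<open>B\<close>.\<close>
  show ?thesis unfolding 7 3 4 using 5 6 by argo
qed


section \<open>The operator norm as a supremum\<close>

lemma cmod_le_l2_norm_n: "i \<in> {1..n} \<Longrightarrow> cmod (x i) \<le> l2_norm_n n x"
  unfolding l2_norm_n_sqnorm sqrt_sqnorm_eq_L2
  by (rule member_le_L2_set) auto

lemma l2_norm_n_cmult: "l2_norm_n n (\<lambda>i. c * x i) = cmod c * l2_norm_n n x"
  by (simp add: l2_norm_n_def norm_mult power_mult_distrib real_sqrt_mult flip: sum_distrib_left)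

lemma mat_apply_cmult: "mat_apply n M (\<lambda>j. c * x j) = (\<lambda>i. c * mat_apply n M x i)"
  by (simp add: mat_apply_def sum_distrib_left mult_ac)

lemma l2_norm_n_nonneg [simp]: "0 \<le> l2_norm_n n x"
  by (simp add: l2_norm_n_def sum_nonneg)

text \<open>A real \<open>Sup\<close> dominates its set only if that set is bounded; the sum of the
  moduli of all entries is a sufficient crude bound.\<close>

lemma bdd_above_op_norm:
  "bdd_above ((\<lambda>x. l2_norm_n n (mat_apply n M x)) ` {x. l2_norm_n n x \<le> 1})"
proof (intro bdd_aboveI2)
  fix x assume x: "x \<in> {x. l2_norm_n n x \<le> 1}"
  have "l2_norm_n n (mat_apply n M x) \<le> (\<Sum>i=1..n. cmod (mat_apply n M x i))"
    unfolding l2_norm_n_sqnorm sqrt_sqnorm_eq_L2 by (rule L2_set_le_sum) auto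
  also have "\<dots> \<le> (\<Sum>i=1..n. \<Sum>j=1..n. cmod (M i j))"
  proof (rule sum_mono)
    fix i assume "i \<in> {1..n}"
    have "cmod (mat_apply n M x i) \<le> (\<Sum>j=1..n. cmod (M i j * x j))"
      unfolding mat_apply_def by (rule norm_sum)
    also have "\<dots> \<le> (\<Sum>j=1..n. cmod (M i j))"
    proof (rule sum_mono)
      fix j assume "j \<in> {1..n}"
      then have "cmod (x j) \<le> 1" using cmod_le_l2_norm_n[of j n x] x by simp
      then show "cmod (M i j * x j) \<le> cmod (M i j)"
        by (simp add: norm_mult mult_left_le)
    qed
    finally show "cmod (mat_apply n M x i) \<le> (\<Sum>j=1..n. cmod (M i j))" .
  qed
  finally show "l2_norm_n n (mat_apply n M x) \<le> (\<Sum>i=1..n. \<Sum>j=1..n. cmod (M i j))" .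
qed

lemma l2_norm_n_mat_apply_le: "l2_norm_n n (mat_apply n M x) \<le> op_norm n M * l2_norm_n n x"
proof (cases "l2_norm_n n x = 0")
  case True
  then have "x j = 0" if "j \<in> {1..n}" for j
    using cmod_le_l2_norm_n[OF that, of x] by simp
  then have "mat_apply n M x = (\<lambda>_. 0)"
    by (simp add: mat_apply_def)
  then show ?thesis using True by (simp add: l2_norm_n_def)
next
  case False
  define t where "t = l2_norm_n n x"
  have t: "t > 0" using False l2_norm_n_nonneg[of n x] unfolding t_def by linarith
  have "l2_norm_n n (mat_apply n M (\<lambda>j. of_real (1/t) * x j)) \<le> op_norm n M"
    unfolding op_norm_def
  proof (rule cSUP_upper[OF _ bdd_above_op_norm])
    show "(\<lambda>j. of_real (1/t) * x j) \<in> {x. l2_norm_n n x \<le> 1}"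
      using t unfolding mem_Collect_eq l2_norm_n_cmult t_def[symmetric] by (simp add: norm_divide)
  qed
  then show ?thesis
    using t unfolding mat_apply_cmult l2_norm_n_cmult
    by (simp add: norm_divide field_simps flip: t_def)
qed

lemma op_norm_leI:
  assumes "\<And>x. l2_norm_n n x \<le> 1 \<Longrightarrow> l2_norm_n n (mat_apply n M x) \<le> K"
  shows "op_norm n M \<le> K"
  unfolding op_norm_def
proof (rule cSUP_least)
  have "l2_norm_n n (\<lambda>_. 0) \<le> 1" by (simp add: l2_norm_n_def)
  then show "{x. l2_norm_n n x \<le> 1} \<noteq> {}" by blast
qed (use assms in auto)

lemma op_norm_nonneg: "0 \<le> op_norm n M"
proof -
  have "0 \<le> l2_norm_n n (mat_apply n M (\<lambda>_. 0))" by simp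
  also have "\<dots> \<le> op_norm n M"
    unfolding op_norm_def
    by (rule cSUP_upper[OF _ bdd_above_op_norm]) (simp add: l2_norm_n_def)
  finally show ?thesis .
qed

section \<open>One-sided paving of Hermitian matrices\<close>

text \<open>The dimension is a parameter because each paving argument stays in one dimension;
  uniformity of \<open>r\<close> in \<open>n\<close> enters only in the final theorem.\<close>

definition triangular_pavable :: "real \<Rightarrow> nat \<Rightarrow> nat \<Rightarrow> bool" where
  "triangular_pavable \<epsilon> r n \<longleftrightarrow> (\<forall>M. triangular n M \<and> zero_diag n M \<longrightarrow>
    (\<exists>A. is_partition n r A \<and> (\<forall>j\<in>{1..r}. op_norm n (compress (A j) M) \<le> \<epsilon> * op_norm n M)))"

text \<open>The conclusion covers every subset of a colour class, so that it survives when several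
  colourings are superposed.\<close>

lemma pave_below:
  assumes pav: "triangular_pavable (1/100) r n"
    and A: "A \<subseteq> {1..n}" and herm: "hermitian_on A S" and diag: "\<And>i. i \<in> A \<Longrightarrow> S i i = 0"
    and bd: "\<And>x. \<bar>Re (qform A S x)\<bar> \<le> sqnorm A x"
  shows "\<exists>f. (\<forall>i\<in>A. f i < r) \<and>
    (\<forall>c B x. B \<subseteq> {i\<in>A. f i = c} \<longrightarrow> - (3/4) * sqnorm B x \<le> Re (qform B S x))"
proof -
  have fin: "finite A" using A finite_subset by blast
  define P where "P = (\<lambda>i j. (if i = j then 2 else 0) + S i j)"
  have hermP: "hermitian_on A P"
    unfolding hermitian_on_def
  proof (intro ballI)
    fix i j assume "i \<in> A" "j \<in> A"
    then have "S j i = cnj (S i j)" using herm unfolding hermitian_on_def by blast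
    then show "P j i = cnj (P i j)" by (simp add: P_def)
  qed
  have coerP: "3/2 * (cmod (v i))\<^sup>2 \<le> Re (qform A P v)" if "i \<in> A" for v i
    unfolding P_def by (rule coercive_coordinate[OF fin that diag[OF that] bd])
  obtain L where L: "\<forall>i\<in>A. \<forall>j\<in>A. i < j \<longrightarrow> L i j = 0"
      "\<forall>i\<in>A. \<exists>d. sqrt (3/2) \<le> d \<and> L i i = complex_of_real d"
      "\<forall>i\<in>A. \<forall>j\<in>A. P i j = (\<Sum>k\<in>A. L i k * cnj (L j k))"
    using cholesky[OF fin _ hermP coerP, simplified] by (elim exE conjE)
  note L1 = L(1)[rule_format] and L2 = L(2)[rule_format] and L3 = L(3)[rule_format]
  define T where "T x k = (\<Sum>i\<in>A. cnj (L i k) * x i)" for x k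
  have PT: "Re (qform A P x) = sqnorm A (T x)" for x
    unfolding T_def using qform_gram[OF L3] by simp
  have PS: "Re (qform A P x) = 2 * sqnorm A x + Re (qform A S x)" for x
    unfolding P_def qform_add qform_scalar[OF fin] by simp
  have diag_low: "sqrt (3/2) \<le> cmod (L i i)" if "i \<in> A" for i
    using L2[OF that] by auto
  \<comment> \<open>Row \<open>i\<close> of \<open>L\<close> has squared norm \<open>P i i\<close>,
    which is 2 because \<open>S i i = 0\<close>.\<close>
  have diag_up: "(cmod (L i i))\<^sup>2 \<le> 2" if "i \<in> A" for i
  proof -
    have "complex_of_real (\<Sum>k\<in>A. (cmod (L i k))\<^sup>2) = complex_of_real 2"
      unfolding of_real_sum complex_norm_square L3[OF that that, symmetric]
      by (simp add: P_def diag that)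
    then have "(\<Sum>k\<in>A. (cmod (L i k))\<^sup>2) = 2"
      by (simp only: of_real_eq_iff)
    moreover have "(cmod (L i i))\<^sup>2 \<le> (\<Sum>k\<in>A. (cmod (L i k))\<^sup>2)"
      using that fin by (intro member_le_sum) auto
    ultimately show ?thesis by simp
  qed
  \<comment> \<open>The strictly upper triangular part of \<open>L\<^sup>*\<close>, extended by zero
    to all of \<open>{1..n}\<close> so that the paving hypothesis applies.\<close>
  define M where "M = (\<lambda>k i. if k \<in> A \<and> i \<in> A \<and> k < i then cnj (L i k) else 0)"
  have M_split: "T x k = cnj (L k k) * x k + (\<Sum>i\<in>A. M k i * x i)" if "k \<in> A" for x k
  proof -
    have "cnj (L i k) * x i = (if i = k then cnj (L k k) * x k else 0) + M k i * x i"
      if "i \<in> A" for i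
      using L1[OF that \<open>k \<in> A\<close>] that \<open>k \<in> A\<close> by (cases i k rule: linorder_cases) (auto simp: M_def)
    then have "T x k = (\<Sum>i\<in>A. (if i = k then cnj (L k k) * x k else 0) + M k i * x i)"
      unfolding T_def by (intro sum.cong) auto
    then show ?thesis using that fin by (simp add: sum.distrib)
  qed
  have Mx: "mat_apply n M x k = (\<Sum>i\<in>A. M k i * x i)" for x k
    unfolding mat_apply_def using A by (intro sum.mono_neutral_right) (auto simp: M_def)
  \<comment> \<open>\<open>M\<close> is \<open>L\<^sup>*\<close> minus its diagonal. On the unit
    ball \<open>L\<^sup>*\<close> has squared norm at most 3 and the diagonal at most 2, so each
    contributes at most 2. No bound for triangular truncation, which would grow with
    \<open>n\<close>, is involved.\<close>
  have "op_norm n M \<le> 4"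
  proof (rule op_norm_leI)
    fix x assume x: "l2_norm_n n x \<le> 1"
    have sx: "sqnorm A x \<le> 1"
      using sqnorm_mono[of "{1..n}" A x] A x by (simp add: l2_norm_n_sqnorm)
    have "sqnorm {1..n} (mat_apply n M x) = sqnorm A (mat_apply n M x)"
      unfolding sqnorm_def Mx using A by (intro sum.mono_neutral_right) (auto simp: M_def)
    also have "\<dots> = sqnorm A (\<lambda>k. T x k + - cnj (L k k) * x k)"
      by (rule sqnorm_cong) (simp add: M_split Mx)
    finally have "l2_norm_n n (mat_apply n M x)
        \<le> sqrt (sqnorm A (T x)) + sqrt (sqnorm A (\<lambda>k. - cnj (L k k) * x k))"
      using sqnorm_triangle[of A "T x" "\<lambda>k. - cnj (L k k) * x k"] by (simp add: l2_norm_n_sqnorm)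
    also have "sqnorm A (T x) \<le> 2\<^sup>2"
      using PT[of x] PS[of x] bd[of x] sx by simp
    then have "sqrt (sqnorm A (T x)) \<le> 2" by (simp add: real_le_lsqrt)
    also have "sqnorm A (\<lambda>k. - cnj (L k k) * x k) \<le> 2 * sqnorm A x"
      unfolding sqnorm_def sum_distrib_left
      by (intro sum_mono) (simp add: norm_mult power_mult_distrib mult_right_mono diag_up)
    then have "sqrt (sqnorm A (\<lambda>k. - cnj (L k k) * x k)) \<le> 2"
      using sx by (intro real_le_lsqrt) auto
    finally show "l2_norm_n n (mat_apply n M x) \<le> 4" by simp
  qed
  moreover have "triangular n M" "zero_diag n M"
    by (auto simp: triangular_def zero_diag_def M_def)
  \<comment> \<open>The bound 1/25 is the paving constant 1/100 times the norm bound 4.\<close>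
  ultimately obtain C where C: "is_partition n r C"
    "\<And>j. j \<in> {1..r} \<Longrightarrow> op_norm n (compress (C j) M) \<le> 1/25"
    using pav unfolding triangular_pavable_def by fastforce
  have "\<forall>i\<in>A. \<exists>j\<in>{1..r}. i \<in> C j" using C(1) A unfolding is_partition_def by blast
  then obtain h where h: "\<And>i. i \<in> A \<Longrightarrow> h i \<in> {1..r} \<and> i \<in> C (h i)" by metis
  \<comment> \<open>Parts are numbered from 1 and colours from 0, hence
    \<open>h i - 1\<close>.\<close>
  have "- (3/4) * sqnorm B x \<le> Re (qform B S x)" if B: "B \<subseteq> {i\<in>A. h i - 1 = c}" for c B x
  proof (cases "B = {}")
    case True
    then show ?thesis by (simp add: sqnorm_def qform_def)
  next
    case False
    define j where "j = c + 1"
    have BA: "B \<subseteq> A" and jr: "j \<in> {1..r}" and BC: "B \<subseteq> C j"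
      using B h False unfolding j_def by fastforce+
    define y where "y = (\<lambda>i. if i \<in> B then x i else 0)"
    have yA: "sqnorm A y = sqnorm B x" "qform A S y = qform B S x"
      unfolding y_def using fin BA by (simp_all add: sqnorm_restrict qform_restrict)
    have yn: "sqnorm {1..n} y = sqnorm B x"
      unfolding y_def using A BA by (intro sqnorm_restrict) auto
    define z where "z = mat_apply n (compress (C j) M) y"
    \<comment> \<open>Since \<open>y\<close> is supported in \<open>B\<close> and \<open>B\<close>
      lies in \<open>C j\<close>, on \<open>B\<close> the compressed matrix acts on \<open>y\<close>
      as \<open>M\<close> does.\<close>
    have z: "z k = (\<Sum>i\<in>A. M k i * y i)" if "k \<in> B" for k
      unfolding Mx[symmetric] unfolding z_def mat_apply_def compress_def y_def
      using that BC by (intro sum.cong) auto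
    have "sqrt (sqnorm B z) \<le> l2_norm_n n z"
      unfolding l2_norm_n_sqnorm using BA A by (intro real_sqrt_le_mono sqnorm_mono) auto
    also have "\<dots> \<le> 1/25 * sqrt (sqnorm B x)"
      using l2_norm_n_mat_apply_le[of n "compress (C j) M" y] C(2)[OF jr]
      unfolding z_def yn[symmetric] l2_norm_n_sqnorm[symmetric]
      by (meson l2_norm_n_nonneg mult_right_mono order_trans)
    finally have zle: "sqrt (sqnorm B z) \<le> 1/25 * sqrt (sqnorm B x)" .
    have "3/2 * sqnorm B x \<le> sqnorm B (\<lambda>k. cnj (L k k) * y k)"
      unfolding sqnorm_def sum_distrib_left
    proof (rule sum_mono)
      fix i assume "i \<in> B"
      then have "3/2 \<le> (cmod (L i i))\<^sup>2"
        using diag_low[of i] BA by (intro sqrt_le_D) auto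
      then have "3/2 * (cmod (x i))\<^sup>2 \<le> (cmod (L i i))\<^sup>2 * (cmod (x i))\<^sup>2"
        by (rule mult_right_mono) simp
      then show "3/2 * (cmod (x i))\<^sup>2 \<le> (cmod (cnj (L i i) * y i))\<^sup>2"
        using \<open>i \<in> B\<close> by (simp add: y_def norm_mult power_mult_distrib)
    qed
    then have "sqrt (3/2) * sqrt (sqnorm B x) \<le> sqrt (sqnorm B (\<lambda>k. cnj (L k k) * y k))"
      by (simp flip: real_sqrt_mult)
    also have "sqnorm B (\<lambda>k. cnj (L k k) * y k) = sqnorm B (\<lambda>k. T y k + - z k)"
      using BA by (intro sqnorm_cong) (auto simp: M_split z)
    also have "sqrt \<dots> \<le> sqrt (sqnorm B (T y)) + sqrt (sqnorm B (\<lambda>k. - z k))"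
      by (rule sqnorm_triangle)
    also have "sqnorm B (\<lambda>k. - z k) = sqnorm B z" by (simp add: sqnorm_def)
    \<comment> \<open>Restoring the coordinates outside \<open>B\<close> is the inequality between
      \<open>Q L Q L\<^sup>* Q\<close> and \<open>Q L L\<^sup>* Q\<close>.\<close>
    also have "sqrt (sqnorm B (T y)) \<le> sqrt (sqnorm A (T y))"
      using fin BA by (simp add: sqnorm_mono)
    finally have 1: "sqrt (3/2) * sqrt (sqnorm B x) \<le> sqrt (sqnorm A (T y)) + sqrt (sqnorm B z)"
      by simp
    \<comment> \<open>Numerically, 6/5 - 1/25 = 29/25, and its square exceeds 5/4 = 2 - 3/4.\<close>
    have "6/5 \<le> sqrt (3/2)" by (rule real_le_rsqrt) (simp add: power2_eq_square)
    then have "6/5 * sqrt (sqnorm B x) \<le> sqrt (3/2) * sqrt (sqnorm B x)"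
      by (intro mult_right_mono) auto
    then have "29/25 * sqrt (sqnorm B x) \<le> sqrt (sqnorm A (T y))"
      using 1 zle by linarith
    then have "(29/25 * sqrt (sqnorm B x))\<^sup>2 \<le> (sqrt (sqnorm A (T y)))\<^sup>2"
      by (intro power_mono) auto
    moreover have "(29/25 * sqrt (sqnorm B x))\<^sup>2 = (29/25)\<^sup>2 * sqnorm B x"
      by (simp only: power_mult_distrib real_sqrt_pow2 sqnorm_nonneg)
    ultimately have "(29/25)\<^sup>2 * sqnorm B x \<le> 2 * sqnorm B x + Re (qform B S x)"
      using PT[of y] PS[of y] by (simp add: yA)
    then show ?thesis
      using sqnorm_nonneg[of B x] unfolding power2_eq_square by linarith
  qed
  moreover have "\<forall>i\<in>A. h i - 1 < r" using h by fastforce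
  ultimately show ?thesis by (intro exI[of _ "\<lambda>i. h i - 1"] conjI allI impI)
qed


section \<open>Two-sided paving and its iteration\<close>

text \<open>The common refinement of two colourings: a pair of colours is coded as a two-digit
  number in base \<open>s\<close>, and \<open>div\<close> and \<open>mod\<close> recover the
  digits.\<close>

lemma refine_colouring:
  fixes f g :: "nat \<Rightarrow> nat"
  assumes "\<And>i. i \<in> A \<Longrightarrow> f i < r" "\<And>i. i \<in> A \<Longrightarrow> g i < s"
  shows "\<forall>i\<in>A. f i * s + g i < r * s"
    and "B \<subseteq> {i\<in>A. f i * s + g i = c} \<Longrightarrow> B \<subseteq> {i\<in>A. f i = c div s} \<and> B \<subseteq> {i\<in>A. g i = c mod s}"
proof -
  show "\<forall>i\<in>A. f i * s + g i < r * s"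
  proof
    fix i assume "i \<in> A"
    then have "f i * s + g i < (f i + 1) * s" using assms(2) by simp
    also have "\<dots> \<le> r * s" using assms(1)[OF \<open>i \<in> A\<close>] by (intro mult_right_mono) auto
    finally show "f i * s + g i < r * s" .
  qed
  show "B \<subseteq> {i\<in>A. f i = c div s} \<and> B \<subseteq> {i\<in>A. g i = c mod s}"
    if "B \<subseteq> {i\<in>A. f i * s + g i = c}"
    using that assms(2) by force
qed

lemma form_bound_subset:
  assumes "finite A" "B \<subseteq> A" "\<And>x. \<bar>Re (qform A S x)\<bar> \<le> b * sqnorm A x"
  shows "\<bar>Re (qform B S x)\<bar> \<le> b * sqnorm B x"
  using assms(3)[of "\<lambda>i. if i \<in> B then x i else 0"]
  by (simp only: qform_restrict[OF assms(1,2)] sqnorm_restrict[OF assms(1,2)])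

text \<open>Superposes the lower-bound colourings for \<open>S\<close> and for \<open>-S\<close>,
  which squares the number of colours.\<close>

lemma pave_unit:
  assumes pav: "triangular_pavable (1/100) r n"
    and A: "A \<subseteq> {1..n}" and herm: "hermitian_on A S" and diag: "\<And>i. i \<in> A \<Longrightarrow> S i i = 0"
    and bd: "\<And>x. \<bar>Re (qform A S x)\<bar> \<le> sqnorm A x"
  shows "\<exists>f. (\<forall>i\<in>A. f i < r * r) \<and>
    (\<forall>c B x. B \<subseteq> {i\<in>A. f i = c} \<longrightarrow> \<bar>Re (qform B S x)\<bar> \<le> 3/4 * sqnorm B x)"
proof -
  obtain f where f: "\<And>i. i \<in> A \<Longrightarrow> f i < r"
    "\<And>c B x. B \<subseteq> {i\<in>A. f i = c} \<Longrightarrow> - (3/4) * sqnorm B x \<le> Re (qform B S x)"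
    using pave_below[OF pav A herm diag bd] by blast
  have "hermitian_on A (\<lambda>i j. - S i j)"
    using hermitian_on_cmult_real[OF herm, of "-1"] by simp
  moreover have "- S i i = 0" if "i \<in> A" for i using diag[OF that] by simp
  moreover have "\<bar>Re (- qform A S x)\<bar> \<le> sqnorm A x" for x using bd[of x] by simp
  ultimately obtain g where g: "\<And>i. i \<in> A \<Longrightarrow> g i < r"
    "\<And>c B x. B \<subseteq> {i\<in>A. g i = c} \<Longrightarrow> - (3/4) * sqnorm B x \<le> Re (- qform B S x)"
    using pave_below[OF pav A, of "\<lambda>i j. - S i j", unfolded qform_minus] by blast
  have "\<bar>Re (qform B S x)\<bar> \<le> 3/4 * sqnorm B x" if "B \<subseteq> {i\<in>A. f i * r + g i = c}" for c B x
  proof -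
    have "B \<subseteq> {i\<in>A. f i = c div r}" "B \<subseteq> {i\<in>A. g i = c mod r}"
      using refine_colouring(2)[OF f(1) g(1) that] by blast+
    from f(2)[OF this(1), of x] g(2)[OF this(2), of x] show ?thesis by simp
  qed
  with refine_colouring(1)[OF f(1) g(1)] show ?thesis
    by (intro exI[of _ "\<lambda>i. f i * r + g i"] conjI allI impI)
qed

text \<open>Follows by homogeneity from \<open>pave_unit\<close> applied to \<open>S / b\<close>;
  \<open>b = 0\<close> is separate because of the division.\<close>

lemma pave_step:
  assumes pav: "triangular_pavable (1/100) r n" and "0 \<le> b"
    and A: "A \<subseteq> {1..n}" and herm: "hermitian_on A S" and diag: "\<And>i. i \<in> A \<Longrightarrow> S i i = 0"
    and bd: "\<And>x. \<bar>Re (qform A S x)\<bar> \<le> b * sqnorm A x"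
  shows "\<exists>f. (\<forall>i\<in>A. f i < r * r) \<and>
    (\<forall>c B x. B \<subseteq> {i\<in>A. f i = c} \<longrightarrow> \<bar>Re (qform B S x)\<bar> \<le> 3/4 * b * sqnorm B x)"
proof (cases "b = 0")
  case True
  have "\<bar>Re (qform A S x)\<bar> \<le> sqnorm A x" for x
    using bd[of x] sqnorm_nonneg[of A x] unfolding True by linarith
  \<comment> \<open>When \<open>b = 0\<close> every colouring meets the bound, but one with values
    below \<open>r * r\<close> must still exist, which for nonempty \<open>A\<close> requires
    \<open>r\<close> to be positive.\<close>
  then obtain f where f: "\<forall>i\<in>A. f i < r * r"
    using pave_unit[OF pav A herm diag] by blast
  have "\<bar>Re (qform B S x)\<bar> \<le> 3/4 * b * sqnorm B x" if "B \<subseteq> {i\<in>A. f i = c}" for c B x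
    using form_bound_subset[OF finite_subset[OF A finite_atLeastAtMost] _ bd, of B x] that True by auto
  with f show ?thesis by blast
next
  case False
  then have b: "b > 0" using assms(2) by simp
  have sc: "Re (qform B (\<lambda>i j. complex_of_real (1/b) * S i j) x) = Re (qform B S x) / b" for B x
    unfolding qform_cmult by simp
  have "\<bar>Re (qform A S x) / b\<bar> \<le> sqnorm A x" for x
    using bd[of x] b by (simp add: abs_divide field_simps)
  then obtain f where f: "\<forall>i\<in>A. f i < r * r"
    "\<And>c B x. B \<subseteq> {i\<in>A. f i = c} \<Longrightarrow> \<bar>Re (qform B S x) / b\<bar> \<le> 3/4 * sqnorm B x"
    using pave_unit[OF pav A hermitian_on_cmult_real[OF herm, of "1/b"], unfolded sc] diag by auto
  have "\<bar>Re (qform B S x)\<bar> \<le> 3/4 * b * sqnorm B x" if "B \<subseteq> {i\<in>A. f i = c}" for c B x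
    using f(2)[OF that, of x] b by (simp add: abs_divide field_simps)
  with f(1) show ?thesis by blast
qed

text \<open>Each colour class is paved again, gaining a factor 3/4 per round. The number of colours
  depends on \<open>r\<close> and \<open>m\<close> only.\<close>

lemma pave_iterate:
  assumes pav: "triangular_pavable (1/100) r n" and "0 \<le> b"
    and A: "A \<subseteq> {1..n}" and herm: "hermitian_on A S" and diag: "\<And>i. i \<in> A \<Longrightarrow> S i i = 0"
    and bd: "\<And>x. \<bar>Re (qform A S x)\<bar> \<le> b * sqnorm A x"
  shows "\<exists>f. (\<forall>i\<in>A. f i < (r * r) ^ m) \<and>
    (\<forall>c B x. B \<subseteq> {i\<in>A. f i = c} \<longrightarrow> \<bar>Re (qform B S x)\<bar> \<le> (3/4) ^ m * b * sqnorm B x)"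
proof (induction m)
  case 0
  have "\<bar>Re (qform B S x)\<bar> \<le> b * sqnorm B x" if "B \<subseteq> {i\<in>A. (0::nat) = c}" for c B x
    using form_bound_subset[OF finite_subset[OF A finite_atLeastAtMost] _ bd, of B x] that by auto
  then show ?case by (intro exI[of _ "\<lambda>_. 0"]) simp
next
  case (Suc m)
  then obtain f where f: "\<And>i. i \<in> A \<Longrightarrow> f i < (r * r) ^ m"
    "\<And>c B x. B \<subseteq> {i\<in>A. f i = c} \<Longrightarrow> \<bar>Re (qform B S x)\<bar> \<le> (3/4) ^ m * b * sqnorm B x"
    by blast
  \<comment> \<open>Each class \<open>c\<close> gets its own colouring; the new colour of
    \<open>i\<close> codes the pair of \<open>f i\<close> and \<open>G (f i) i\<close>.\<close>
  have "\<forall>c. \<exists>g. (\<forall>i\<in>{i\<in>A. f i = c}. g i < r * r) \<and>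
    (\<forall>d B x. B \<subseteq> {i\<in>{i\<in>A. f i = c}. g i = d} \<longrightarrow>
      \<bar>Re (qform B S x)\<bar> \<le> 3/4 * ((3/4) ^ m * b) * sqnorm B x)"
  proof (intro allI pave_step[OF pav])
    fix c
    show "{i\<in>A. f i = c} \<subseteq> {1..n}" using A by blast
    show "hermitian_on {i\<in>A. f i = c} S" by (rule hermitian_on_subset[OF herm]) blast
  qed (use \<open>0 \<le> b\<close> diag f(2) in auto)
  then obtain G where "\<forall>c. (\<forall>i\<in>{i\<in>A. f i = c}. G c i < r * r) \<and>
    (\<forall>d B x. B \<subseteq> {i\<in>{i\<in>A. f i = c}. G c i = d} \<longrightarrow>
      \<bar>Re (qform B S x)\<bar> \<le> 3/4 * ((3/4) ^ m * b) * sqnorm B x)"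
    by (rule exE[OF choice])
  then have G: "\<And>c i. i \<in> A \<Longrightarrow> f i = c \<Longrightarrow> G c i < r * r"
    "\<And>c d B x. B \<subseteq> {i\<in>{i\<in>A. f i = c}. G c i = d} \<Longrightarrow>
      \<bar>Re (qform B S x)\<bar> \<le> 3/4 * ((3/4) ^ m * b) * sqnorm B x"
    by blast+
  have g: "G (f i) i < r * r" if "i \<in> A" for i using G(1)[OF that refl] .
  have "\<bar>Re (qform B S x)\<bar> \<le> (3/4) ^ Suc m * b * sqnorm B x"
    if B: "B \<subseteq> {i\<in>A. f i * (r * r) + G (f i) i = c}" for c B x
  proof -
    have "B \<subseteq> {i\<in>{i\<in>A. f i = c div (r * r)}. G (c div (r * r)) i = c mod (r * r)}"
    proof
      fix i assume "i \<in> B"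
      with refine_colouring(2)[OF f(1) g B]
      have "i \<in> A" "f i = c div (r * r)" "G (f i) i = c mod (r * r)" by blast+
      then show "i \<in> {i\<in>{i\<in>A. f i = c div (r * r)}. G (c div (r * r)) i = c mod (r * r)}" by simp
    qed
    from G(2)[OF this, of x] show ?thesis by (simp add: mult_ac)
  qed
  moreover have "\<forall>i\<in>A. f i * (r * r) + G (f i) i < (r * r) ^ Suc m"
    using refine_colouring(1)[OF f(1) g] by (simp add: mult_ac)
  ultimately show ?case by (intro exI[of _ "\<lambda>i. f i * (r * r) + G (f i) i"]) blast
qed

section \<open>Numerical radius and arbitrary operators\<close>

text \<open>Polarisation against the unit vector in the direction of \<open>M x\<close>, combined
  with the parallelogram law. The absolute value covers \<open>n = 0\<close>, where \<open>w\<close>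
  may be negative.\<close>

lemma op_norm_le_numerical_radius:
  assumes w: "\<And>x. cmod (qform {1..n} M x) \<le> w * sqnorm {1..n} x"
  shows "op_norm n M \<le> 2 * \<bar>w\<bar>"
proof (rule op_norm_leI)
  fix x assume x: "l2_norm_n n x \<le> 1"
  define s where "s = l2_norm_n n (mat_apply n M x)"
  show "l2_norm_n n (mat_apply n M x) \<le> 2 * \<bar>w\<bar>"
  proof (cases "s = 0")
    case True
    then show ?thesis by (simp add: s_def)
  next
    case False
    then have s: "s > 0" using l2_norm_n_nonneg[of n "mat_apply n M x"] unfolding s_def by linarith
    have s2: "sqnorm {1..n} (mat_apply n M x) = s\<^sup>2"
      by (simp add: s_def l2_norm_n_sqnorm)
    define y where "y = (\<lambda>i. complex_of_real (1/s) * mat_apply n M x i)"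
    have sy: "sqnorm {1..n} y = 1"
      using s s2 by (simp add: y_def sqnorm_def norm_divide norm_mult power_mult_distrib power_divide
          flip: sum_divide_distrib)
    have sx: "sqnorm {1..n} x \<le> 1" using x by (simp add: l2_norm_n_sqnorm)
    define q where "q c = qform {1..n} M (\<lambda>i. x i + c * y i)" for c
    define p where "p c = sqnorm {1..n} (\<lambda>i. x i + c * y i)" for c
    \<comment> \<open>The parallelogram law, once for \<open>y\<close> and once for
      \<open>\<i> * y\<close>.\<close>
    have p: "p 1 + p (-1) + p \<i> + p (-\<i>) = 4 * (sqnorm {1..n} x + sqnorm {1..n} y)"
      unfolding p_def sqnorm_def sum.distrib[symmetric] sum_distrib_left
      unfolding cmod_power2 by (intro sum.cong refl) (simp add: power2_eq_square algebra_simps)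
    \<comment> \<open>Polarisation for a form conjugate-linear in its first argument: only the terms
      pairing \<open>y\<close> with \<open>M x\<close> survive.\<close>
    have "q 1 - q (-1) + \<i> * q \<i> - \<i> * q (-\<i>) = (\<Sum>i=1..n. \<Sum>j=1..n. 4 * (cnj (y i) * M i j * x j))"
      unfolding q_def qform_def sum_distrib_left sum.distrib[symmetric] sum_subtractf[symmetric]
      by (intro sum.cong refl) (simp add: algebra_simps)
    also have "\<dots> = 4 * (\<Sum>i=1..n. cnj (y i) * mat_apply n M x i)"
      unfolding mat_apply_def by (simp add: sum_distrib_left mult_ac)
    also have "(\<Sum>i=1..n. cnj (y i) * mat_apply n M x i) = complex_of_real (1/s) *
        (\<Sum>i=1..n. cnj (mat_apply n M x i) * mat_apply n M x i)"
      by (simp add: y_def sum_distrib_left mult_ac)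
    also have "\<dots> = complex_of_real (1/s * sqnorm {1..n} (mat_apply n M x))"
      by (simp add: sqnorm_def cnj_mult_self)
    also have "\<dots> = s" using s unfolding s2 by (simp add: power2_eq_square)
    finally have "4 * s = cmod (q 1 - q (-1) + \<i> * q \<i> - \<i> * q (-\<i>))"
      using s by (simp add: norm_mult)
    also have "\<dots> \<le> cmod (q 1) + cmod (q (-1)) + cmod (\<i> * q \<i>) + cmod (\<i> * q (-\<i>))"
      by (intro order_trans[OF norm_triangle_ineq4] order_trans[OF norm_triangle_ineq] add_mono order_refl)
    also have "\<dots> \<le> w * p 1 + w * p (-1) + w * p \<i> + w * p (-\<i>)"
      unfolding q_def p_def norm_mult norm_ii mult_1_left by (intro add_mono w)
    also have "\<dots> = w * (p 1 + p (-1) + p \<i> + p (-\<i>))"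
      by (simp only: distrib_left)
    also have "\<dots> = w * (4 * (sqnorm {1..n} x + 1))"
      unfolding p sy ..
    also have "\<dots> \<le> \<bar>w\<bar> * (4 * 2)"
      using sx by (intro mult_mono) auto
    finally show ?thesis by (simp add: s_def)
  qed
qed

lemma cmod_qform_le_op_norm: "cmod (qform {1..n} T x) \<le> op_norm n T * sqnorm {1..n} x"
proof -
  have "qform {1..n} T x = (\<Sum>i=1..n. cnj (x i) * mat_apply n T x i)"
    by (simp add: qform_def mat_apply_def sum_distrib_left mult_ac)
  also have "cmod \<dots> \<le> (\<Sum>i=1..n. \<bar>cmod (x i)\<bar> * \<bar>cmod (mat_apply n T x i)\<bar>)"
    by (rule sum_norm_le) (simp add: norm_mult)
  also have "\<dots> \<le> l2_norm_n n x * l2_norm_n n (mat_apply n T x)"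
    unfolding l2_norm_n_sqnorm sqrt_sqnorm_eq_L2 by (rule L2_set_mult_ineq)
  also have "\<dots> \<le> l2_norm_n n x * (op_norm n T * l2_norm_n n x)"
    by (intro mult_left_mono l2_norm_n_mat_apply_le) simp
  also have "\<dots> = op_norm n T * sqnorm {1..n} x"
    by (simp add: l2_norm_n_sqnorm)
  finally show ?thesis .
qed

lemma qform_compress:
  assumes "B \<subseteq> {1..n}"
  shows "qform {1..n} (compress B M) x = qform B M x"
proof -
  have "qform {1..n} (compress B M) x = qform {1..n} M (\<lambda>i. if i \<in> B then x i else 0)"
    unfolding qform_def compress_def by (intro sum.cong refl) auto
  then show ?thesis using assms by (simp add: qform_restrict)
qed

text \<open>The factor 4 is 2 for adding real and imaginary parts, times 2 for passing from the
  numerical radius to the norm.\<close>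

lemma pave_general:
  assumes pav: "triangular_pavable (1/100) r n" and diag: "zero_diag n T"
  shows "\<exists>A. is_partition n ((r * r) ^ m * (r * r) ^ m) A \<and>
    (\<forall>j\<in>{1..(r * r) ^ m * (r * r) ^ m}. op_norm n (compress (A j) T) \<le> 4 * (3/4) ^ m * op_norm n T)"
proof -
  define R where "R = (r * r) ^ m"
  define t where "t = op_norm n T"
  \<comment> \<open>Twice the real and imaginary parts of \<open>T\<close>: their forms are
    \<open>2 * Re\<close> and \<open>2 * Im\<close> of the form of \<open>T\<close>, so both are
    bounded by \<open>2 * t\<close>.\<close>
  define S1 where "S1 = (\<lambda>i j. T i j + cnj (T j i))"
  define S2 where "S2 = (\<lambda>i j. - \<i> * (T i j + - cnj (T j i)))"
  have t: "0 \<le> 2 * t" by (simp add: t_def op_norm_nonneg)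
  have herm: "hermitian_on {1..n} S1" "hermitian_on {1..n} S2"
    by (simp_all add: hermitian_on_def S1_def S2_def algebra_simps)
  have diag12: "S1 i i = 0" "S2 i i = 0" if "i \<in> {1..n}" for i
    using that diag by (simp_all add: S1_def S2_def zero_diag_def)
  have re: "Re (qform B S1 x) = 2 * Re (qform B T x)" for B x
    unfolding S1_def qform_add qform_adjoint by simp
  have im: "Re (qform B S2 x) = 2 * Im (qform B T x)" for B x
    unfolding S2_def qform_cmult qform_add qform_minus qform_adjoint by simp
  have bd: "\<bar>Re (qform {1..n} S1 x)\<bar> \<le> 2 * t * sqnorm {1..n} x"
    "\<bar>Re (qform {1..n} S2 x)\<bar> \<le> 2 * t * sqnorm {1..n} x" for x
    using cmod_qform_le_op_norm[of n T x] abs_Re_le_cmod[of "qform {1..n} T x"]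
      abs_Im_le_cmod[of "qform {1..n} T x"] by (simp_all add: re im t_def)
  obtain f where f: "\<And>i. i \<in> {1..n} \<Longrightarrow> f i < R"
    "\<And>c B x. B \<subseteq> {i\<in>{1..n}. f i = c} \<Longrightarrow> \<bar>Re (qform B S1 x)\<bar> \<le> (3/4) ^ m * (2 * t) * sqnorm B x"
    using pave_iterate[OF pav t subset_refl herm(1) diag12(1) bd(1), of m] unfolding R_def by blast
  obtain g where g: "\<And>i. i \<in> {1..n} \<Longrightarrow> g i < R"
    "\<And>c B x. B \<subseteq> {i\<in>{1..n}. g i = c} \<Longrightarrow> \<bar>Re (qform B S2 x)\<bar> \<le> (3/4) ^ m * (2 * t) * sqnorm B x"
    using pave_iterate[OF pav t subset_refl herm(2) diag12(2) bd(2), of m] unfolding R_def by blast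
  define h where "h i = f i * R + g i" for i
  \<comment> \<open>Colours start at 0 and parts at 1, hence \<open>j - 1\<close>.\<close>
  define A where "A j = {i\<in>{1..n}. h i = j - 1}" for j
  have h: "h i < R * R" if "i \<in> {1..n}" for i
    using bspec[OF refine_colouring(1)[OF f(1) g(1)] that] unfolding h_def .
  have "is_partition n (R * R) A"
    unfolding is_partition_def
  proof (intro conjI ballI impI)
    show "(\<Union>j\<in>{1..R * R}. A j) = {1..n}"
    proof (intro equalityI subsetI)
      fix i assume i: "i \<in> {1..n}"
      then have "i \<in> A (h i + 1)" "h i + 1 \<in> {1..R * R}"
        using h[OF i] by (simp_all add: A_def)
      then show "i \<in> (\<Union>j\<in>{1..R * R}. A j)" by blast
    qed (auto simp: A_def)
    show "A j \<inter> A k = {}" if "j \<in> {1..R * R}" "k \<in> {1..R * R}" "j \<noteq> k" for j k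
      using that by (auto simp: A_def)
  qed
  moreover have "op_norm n (compress (A j) T) \<le> 4 * (3/4) ^ m * t" for j
  proof -
    have sub: "A j \<subseteq> {1..n}" by (auto simp: A_def)
    have "A j \<subseteq> {i\<in>{1..n}. f i * R + g i = j - 1}" by (auto simp: A_def h_def)
    from refine_colouring(2)[OF f(1) g(1) this]
    have fg: "A j \<subseteq> {i\<in>{1..n}. f i = (j - 1) div R}" "A j \<subseteq> {i\<in>{1..n}. g i = (j - 1) mod R}"
      by blast+
    have "cmod (qform {1..n} (compress (A j) T) x) \<le> (2 * (3/4) ^ m * t) * sqnorm {1..n} x" for x
    proof -
      have "cmod (qform (A j) T x) \<le> \<bar>Re (qform (A j) T x)\<bar> + \<bar>Im (qform (A j) T x)\<bar>"
        by (rule cmod_le)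
      also have "\<dots> \<le> (2 * (3/4) ^ m * t) * sqnorm (A j) x"
        using f(2)[OF fg(1), of x] g(2)[OF fg(2), of x] by (simp add: re im mult_ac)
      also have "\<dots> \<le> (2 * (3/4) ^ m * t) * sqnorm {1..n} x"
        using t sub by (intro mult_left_mono sqnorm_mono) auto
      finally show ?thesis unfolding qform_compress[OF sub] .
    qed
    from op_norm_le_numerical_radius[OF this] show ?thesis using t by (simp add: abs_mult)
  qed
  ultimately show ?thesis unfolding R_def t_def by blast
qed

theorem theorem3p1:
  shows "(\<forall>\<epsilon>::real. \<epsilon> > 0 \<longrightarrow> (\<exists>r::nat. \<forall>n::nat. \<forall>M.
            zero_diag n M \<longrightarrow>
            (\<exists>A. is_partition n r A \<and>
                 (\<forall>j\<in>{1..r}. op_norm n (compress (A j) M) \<le> \<epsilon> * op_norm n M))))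
     \<longleftrightarrow>
     (\<forall>\<epsilon>::real. \<epsilon> > 0 \<longrightarrow> (\<exists>r::nat. \<forall>n::nat. \<forall>M.
            triangular n M \<and> zero_diag n M \<longrightarrow>
            (\<exists>A. is_partition n r A \<and>
                 (\<forall>j\<in>{1..r}. op_norm n (compress (A j) M) \<le> \<epsilon> * op_norm n M))))"
    (is "?PC \<longleftrightarrow> ?PCT")
proof
  show "?PC \<Longrightarrow> ?PCT" by blast
next
  assume ?PCT
  \<comment> \<open>The triangular hypothesis is used at the single value 1/100; small
    \<open>\<epsilon>\<close> is reached by iteration.\<close>
  then have "\<exists>r. \<forall>n. triangular_pavable (1/100) r n"
    unfolding triangular_pavable_def by (elim allE[of _ "1/100"]) simp
  then obtain r where r: "\<And>n. triangular_pavable (1/100) r n" by blast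
  show ?PC
  proof (intro allI impI)
    fix \<epsilon> :: real assume "\<epsilon> > 0"
    then obtain m where m: "(3/4::real) ^ m < \<epsilon> / 4"
      using real_arch_pow_inv[of "\<epsilon> / 4" "3/4"] by auto
    \<comment> \<open>\<open>m\<close> depends on \<open>\<epsilon>\<close> alone and
      \<open>r\<close> is fixed, so \<open>R\<close> is independent of \<open>n\<close> and
      \<open>M\<close>.\<close>
    define R where "R = (r * r) ^ m * (r * r) ^ m"
    have "\<exists>A. is_partition n R A \<and> (\<forall>j\<in>{1..R}. op_norm n (compress (A j) M) \<le> \<epsilon> * op_norm n M)"
      if M: "zero_diag n M" for n M
    proof -
      obtain A where A: "is_partition n R A"
        "\<And>j. j \<in> {1..R} \<Longrightarrow> op_norm n (compress (A j) M) \<le> 4 * (3/4) ^ m * op_norm n M"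
        using pave_general[OF r M, of m] unfolding R_def by blast
      have "4 * (3/4) ^ m * op_norm n M \<le> \<epsilon> * op_norm n M"
        using m by (intro mult_right_mono op_norm_nonneg) simp
      with A show ?thesis by (meson order_trans)
    qed
    then show "\<exists>r. \<forall>n M. zero_diag n M \<longrightarrow> (\<exists>A. is_partition n r A \<and>
        (\<forall>j\<in>{1..r}. op_norm n (compress (A j) M) \<le> \<epsilon> * op_norm n M))"
      by blast
  qed
qed

end
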